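(* Let $\mathcal{H}$ be a complex separable Hilbert space, let $A$ be a bounded and injective operator on $\mathcal{H}$, let $g\in\operatorname{ran}A$, and let $f\in\mathcal{H}$ be the solution to $Af=g$. If $A$ is $\mathcal{K}(A,g)$-reduced, then $f\in\overline{\mathcal{K}(A,g)}$. In particular, if $A$ is bounded, injective, and self-adjoint, then $Af=g$ implies $f\in\overline{\mathcal{K}(A,g)}$.
   Context: Bounded operators on $\mathcal{H}$ are linear and everywhere defined. For a bounded operator $A$ on $\mathcal{H}$ and $g\in\mathcal{H}$, the Krylov subspace is $\mathcal{K}(A,g):=\operatorname{span}\{A^kg\mid k\in\mathbb{N}_0\}$ (finite linear combinations, $\mathbb{N}_0=\{0,1,2,\dots\}$), $\overline{\mathcal{K}(A,g)}$ is its closure in the norm of $\mathcal{H}$, and $\mathcal{K}(A,g)^\perp$ is its orthogonal complement. The operator $A$ is called $\mathcal{K}(A,g)$-reduced if both $\overline{\mathcal{K}(A,g)}$ and $\mathcal{K}(A,g)^\perp$ are invariant under $A$, i.e. $A\,\overline{\mathcal{K}(A,g)}\subset\overline{\mathcal{K}(A,g)}$ and $A\,\mathcal{K}(A,g)^\perp\subset\mathcal{K}(A,g)^\perp$. *)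

theory Defs
  imports "HOL-Analysis.Analysis"
begin

text \<open>
  Complex inner product spaces are added on top of \<^class>\<open>real_normed_vector\<close>, so that
  norm, metric, topology, closure and completeness are those of the library. The axiom
  \<open>scaleR_eq_scaleC\<close> makes the library's real scaling the restriction of the complex one,
  \<open>norm_eq_sqrt_cinner\<close> makes the library's norm the one induced by the inner product.
  The inner product is linear in the first argument and conjugate-linear in the second.
\<close>

class complex_inner = real_normed_vector +
  fixes scaleC :: "complex \<Rightarrow> 'a \<Rightarrow> 'a" (infixr \<open>*\<^sub>C\<close> 75)
    and cinner :: "'a \<Rightarrow> 'a \<Rightarrow> complex"
  assumes scaleC_add_right: "a *\<^sub>C (x + y) = a *\<^sub>C x + a *\<^sub>C y"
    and scaleC_add_left: "(a + b) *\<^sub>C x = a *\<^sub>C x + b *\<^sub>C x"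
    and scaleC_scaleC: "a *\<^sub>C (b *\<^sub>C x) = (a * b) *\<^sub>C x"
    and scaleC_one: "1 *\<^sub>C x = x"
    and scaleR_eq_scaleC: "r *\<^sub>R x = complex_of_real r *\<^sub>C x"
    and cinner_commute: "cinner x y = cnj (cinner y x)"
    and cinner_add_left: "cinner (x + y) z = cinner x z + cinner y z"
    and cinner_scaleC_left: "cinner (a *\<^sub>C x) y = a * cinner x y"
    and cinner_self_nonneg: "0 \<le> Re (cinner x x)"
    and cinner_eq_zero_iff: "cinner x x = 0 \<longleftrightarrow> x = 0"
    and norm_eq_sqrt_cinner: "norm x = sqrt (Re (cinner x x))"

class chilbert_space = complex_inner + complete_space

instantiation complex :: chilbert_space
begin

definition scaleC_complex :: "complex \<Rightarrow> complex \<Rightarrow> complex"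
  where "scaleC_complex a x = a * x"

definition cinner_complex :: "complex \<Rightarrow> complex \<Rightarrow> complex"
  where "cinner_complex x y = x * cnj y"

instance
  by standard
    (auto simp: scaleC_complex_def cinner_complex_def algebra_simps scaleR_conv_of_real
      cmod_def power2_eq_square)

end

global_interpretation complex_vector: vector_space "scaleC :: complex \<Rightarrow> 'a \<Rightarrow> 'a::complex_inner"
  defines cspan = complex_vector.span
  by unfold_locales (simp_all add: scaleC_add_right scaleC_add_left scaleC_scaleC scaleC_one)

definition bounded_clinear :: "('a::complex_inner \<Rightarrow> 'b::complex_inner) \<Rightarrow> bool"
  where "bounded_clinear A \<longleftrightarrow>
    Vector_Spaces.linear scaleC scaleC A \<and> (\<exists>K. \<forall>x. norm (A x) \<le> K * norm x)"

definition orthocomplement :: "'a::complex_inner set \<Rightarrow> 'a set"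
  where "orthocomplement S = {x. \<forall>y\<in>S. cinner x y = 0}"

definition is_cadjoint :: "('a::complex_inner \<Rightarrow> 'b::complex_inner) \<Rightarrow> ('b \<Rightarrow> 'a) \<Rightarrow> bool"
  where "is_cadjoint A B \<longleftrightarrow> (\<forall>x y. cinner (A x) y = cinner x (B y))"

text \<open>For everywhere defined operators no domain condition enters: \<open>A = A\<^sup>*\<close> says that
  \<open>A\<close> is an adjoint of itself.\<close>

definition selfadjoint :: "('a::complex_inner \<Rightarrow> 'a) \<Rightarrow> bool"
  where "selfadjoint A \<longleftrightarrow> is_cadjoint A A"

definition krylov :: "('a::complex_inner \<Rightarrow> 'a) \<Rightarrow> 'a \<Rightarrow> 'a set"
  where "krylov A g = cspan {(A ^^ k) g |k. k \<in> (UNIV :: nat set)}"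

definition krylov_reduced :: "('a::complex_inner \<Rightarrow> 'a) \<Rightarrow> 'a \<Rightarrow> bool"
  where "krylov_reduced A g \<longleftrightarrow>
    A ` closure (krylov A g) \<subseteq> closure (krylov A g) \<and>
    A ` orthocomplement (krylov A g) \<subseteq> orthocomplement (krylov A g)"

end

theory Submission
  imports Defs
begin

text \<open>
  Let \<open>M\<close> be the closure of the Krylov subspace \<open>K\<close>. Completeness splits the solution as
  \<open>f = u + v\<close> with \<open>u \<in> M\<close> and \<open>v\<close> orthogonal to \<open>K\<close> (\<open>orthogonal_decomposition\<close>). If \<open>A\<close>
  is reduced, then \<open>A v = g - A u\<close> lies in \<open>M\<close>, because \<open>g \<in> K\<close> and \<open>M\<close> is invariant, and
  \<open>A v\<close> is orthogonal to \<open>K\<close>, because the orthogonal complement is invariant. Only zero has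
  both properties (\<open>closure_orthocomplement_zero\<close>), so injectivity forces \<open>v = 0\<close> and \<open>f = u\<close>.

  A self-adjoint operator is reduced: boundedness carries the invariance of \<open>K\<close> over to its
  closure, and self-adjointness carries it over to the orthogonal complement.
\<close>

section \<open>Complex inner products\<close>

lemma cinner_add_right: "cinner x (y + z) = cinner x y + cinner x z"
  by (metis cinner_add_left cinner_commute complex_cnj_add)

lemma cinner_scaleC_right: "cinner x (a *\<^sub>C y) = cnj a * cinner x y"
  by (metis cinner_commute cinner_scaleC_left complex_cnj_mult)

lemma scaleC_minus_one: "(-1) *\<^sub>C x = - (x::'a::complex_inner)"
  using complex_vector.scale_minus_left[of 1 x] by simp

lemma cinner_minus_left: "cinner (- x) y = - cinner x y"
  by (metis cinner_scaleC_left mult_minus1 scaleC_minus_one)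

lemma cinner_minus_right: "cinner x (- y) = - cinner x y"
  by (metis cinner_commute cinner_minus_left complex_cnj_minus)

lemma cinner_diff_left: "cinner (x - y) z = cinner x z - cinner y z"
  using cinner_add_left[of x "- y" z] by (simp add: cinner_minus_left)

lemma cinner_diff_right: "cinner x (y - z) = cinner x y - cinner x z"
  using cinner_add_right[of x y "- z"] by (simp add: cinner_minus_right)

lemma norm_square_cinner: "(norm x)\<^sup>2 = Re (cinner x x)"
  by (simp add: norm_eq_sqrt_cinner cinner_self_nonneg)

lemma cinner_self: "cinner x x = complex_of_real ((norm x)\<^sup>2)"
proof -
  have "Im (cinner x x) = 0"
    using cinner_commute[of x x] by (metis cnj.sel(2) equal_neg_zero)
  then show ?thesis
    by (simp add: complex_eq_iff norm_square_cinner)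
qed

lemma norm_scaleC: "norm (c *\<^sub>C x) = cmod c * norm x"
proof -
  have "complex_of_real ((norm (c *\<^sub>C x))\<^sup>2) = c * (cnj c * complex_of_real ((norm x)\<^sup>2))"
    unfolding cinner_self[symmetric] by (simp add: cinner_scaleC_left cinner_scaleC_right)
  also have "\<dots> = complex_of_real ((cmod c * norm x)\<^sup>2)"
    by (simp add: power_mult_distrib complex_norm_square mult.assoc del: of_real_power)
  finally have "(norm (c *\<^sub>C x))\<^sup>2 = (cmod c * norm x)\<^sup>2"
    using of_real_eq_iff by blast
  then show ?thesis
    by simp
qed

lemma parallelogram_law:
  fixes x y :: "'a::complex_inner"
  shows "(norm (x + y))\<^sup>2 + (norm (x - y))\<^sup>2 = 2 * (norm x)\<^sup>2 + 2 * (norm y)\<^sup>2"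
  unfolding norm_square_cinner
  by (simp add: cinner_add_left cinner_add_right cinner_diff_left cinner_diff_right)

lemma pythagoras:
  assumes "cinner x y = 0"
  shows "(norm (x + y))\<^sup>2 = (norm x)\<^sup>2 + (norm y)\<^sup>2"
proof -
  have "cinner y x = 0"
    using assms by (metis cinner_commute complex_cnj_zero)
  then show ?thesis
    using assms by (simp add: norm_square_cinner cinner_add_left cinner_add_right)
qed

section \<open>Closures of subspaces\<close>

text \<open>A bounded linear map is Lipschitz, hence passes to limits. Applied to a scalar multiple
  and to an operator, this is what makes closures of subspaces well behaved.\<close>

lemma continuous_on_bounded_clinear:
  assumes "bounded_clinear A"
  shows "continuous_on S A"
proof -
  interpret A: Vector_Spaces.linear scaleC scaleC A
    using assms by (simp add: bounded_clinear_def)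
  obtain K where K: "\<And>x. norm (A x) \<le> K * norm x"
    using assms by (auto simp: bounded_clinear_def)
  have "bounded_linear A"
    by (rule bounded_linear_intro[of _ K])
      (simp_all add: A.add A.scale scaleR_eq_scaleC K mult.commute)
  then show ?thesis
    using linear_continuous_on by blast
qed

lemma continuous_on_scaleC: "continuous_on S ((*\<^sub>C) c)"
  by (rule continuous_on_bounded_clinear)
    (auto simp: bounded_clinear_def norm_scaleC complex_vector.linear_scale_self
      intro: exI[of _ "cmod c"])

lemma subspace_closure:
  assumes "complex_vector.subspace S"
  shows "complex_vector.subspace (closure S)"
proof (rule complex_vector.subspaceI)
  show "0 \<in> closure S"
    using assms closure_subset complex_vector.subspace_0 by blast
next
  fix x y assume "x \<in> closure S" "y \<in> closure S"
  then obtain a b where "\<forall>n. a n \<in> S" "a \<longlonglongrightarrow> x" "\<forall>n. b n \<in> S" "b \<longlonglongrightarrow> y"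
    by (auto simp: closure_sequential)
  then have "\<forall>n. a n + b n \<in> S" "(\<lambda>n. a n + b n) \<longlonglongrightarrow> x + y"
    using assms by (auto intro: complex_vector.subspace_add tendsto_add)
  then show "x + y \<in> closure S"
    by (auto simp: closure_sequential)
next
  fix c x assume "x \<in> closure S"
  moreover have "(*\<^sub>C) c ` closure S \<subseteq> closure S"
    using assms closure_subset
    by (intro image_closure_subset continuous_on_scaleC)
      (auto dest: complex_vector.subspace_scale)
  ultimately show "c *\<^sub>C x \<in> closure S"
    by blast
qed

text \<open>By Pythagoras a vector orthogonal to \<open>S\<close> has distance at least its own norm from every
  point of \<open>S\<close>, so \<open>S\<close> can approximate it only if it vanishes.\<close>

lemma closure_orthocomplement_zero:
  assumes "w \<in> closure S" and "w \<in> orthocomplement S"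
  shows "w = 0"
proof (rule ccontr)
  assume "w \<noteq> 0"
  then obtain y where y: "y \<in> S" "dist y w < norm w"
    using assms(1) by (metis closure_approachable zero_less_norm_iff)
  have "cinner w (- y) = 0"
    using assms(2) y by (simp add: orthocomplement_def cinner_minus_right)
  from pythagoras[OF this] have "(norm (w - y))\<^sup>2 = (norm w)\<^sup>2 + (norm y)\<^sup>2"
    by simp
  then have "norm w \<le> norm (w - y)"
    by (simp add: power2_le_imp_le)
  then show False
    using y by (simp add: dist_norm norm_minus_commute)
qed

section \<open>Orthogonal projection\<close>

text \<open>The parallelogram law applied to \<open>x - y\<close> and \<open>x - z\<close> bounds the distance of two
  almost nearest points \<open>y\<close> and \<open>z\<close>, since their midpoint is no nearer to \<open>x\<close> than the
  infimum. Hence minimizing sequences are Cauchy, and completeness supplies a nearest point.\<close>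

lemma nearest_point_exists:
  fixes S :: "'a::chilbert_space set"
  assumes "complex_vector.subspace S" and "closed S"
  obtains u where "u \<in> S" and "\<And>y. y \<in> S \<Longrightarrow> norm (x - u) \<le> norm (x - y)"
proof -
  define d where "d = infdist x S"
  have ne: "S \<noteq> {}"
    using assms(1) complex_vector.subspace_0 by blast
  have d_le: "d \<le> norm (x - y)" if "y \<in> S" for y
    using infdist_le[OF that, of x] by (simp add: d_def dist_norm)
  have d_nonneg: "0 \<le> d"
    by (simp add: d_def infdist_nonneg)
  have "\<exists>y\<in>S. norm (x - y) < d + inverse (real (Suc n))" for n
  proof (rule ccontr)
    assume "\<not> ?thesis"
    then have "d + inverse (real (Suc n)) \<le> infdist x S"
      unfolding infdist_notempty[OF ne] by (intro cINF_greatest ne) (auto simp: dist_norm)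
    then show False
      by (simp add: d_def)
  qed
  then obtain Y where Y: "\<And>n. Y n \<in> S" "\<And>n. norm (x - Y n) < d + inverse (real (Suc n))"
    by metis
  have norm_lim: "(\<lambda>n. norm (x - Y n)) \<longlonglongrightarrow> d"
  proof (rule tendsto_sandwich[OF _ _ tendsto_const])
    show "(\<lambda>n. d + inverse (real (Suc n))) \<longlonglongrightarrow> d"
      using tendsto_add[OF tendsto_const LIMSEQ_inverse_real_of_nat, of d] by simp
  qed (use Y d_le in \<open>auto intro!: always_eventually intro: less_imp_le simp del: of_nat_Suc\<close>)
  have near: "(norm (y - z))\<^sup>2 \<le> 2 * ((norm (x - y))\<^sup>2 - d\<^sup>2) + 2 * ((norm (x - z))\<^sup>2 - d\<^sup>2)"
    if "y \<in> S" "z \<in> S" for y z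
  proof -
    have "(1/2) *\<^sub>R (y + z) \<in> S"
      using assms(1) that
      by (simp add: scaleR_eq_scaleC complex_vector.subspace_add complex_vector.subspace_scale)
    then have "d \<le> norm (x - (1/2) *\<^sub>R (y + z))"
      by (rule d_le)
    moreover have "(x - y) + (x - z) = 2 *\<^sub>R (x - (1/2) *\<^sub>R (y + z))"
      by (simp add: scaleR_2 algebra_simps)
    ultimately have "2 * d \<le> norm ((x - y) + (x - z))"
      by simp
    then have "(2 * d)\<^sup>2 \<le> (norm ((x - y) + (x - z)))\<^sup>2"
      using d_nonneg by (intro power_mono) auto
    then show ?thesis
      using parallelogram_law[of "x - y" "x - z"]
      by (simp add: norm_minus_commute power_mult_distrib)
  qed
  have "Cauchy Y"
  proof (rule metric_CauchyI)
    fix e :: real assume e: "0 < e"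
    have "(\<lambda>n. (norm (x - Y n))\<^sup>2 - d\<^sup>2) \<longlonglongrightarrow> d\<^sup>2 - d\<^sup>2"
      by (intro tendsto_intros norm_lim)
    then have "\<forall>\<^sub>F n in sequentially. (norm (x - Y n))\<^sup>2 - d\<^sup>2 < e\<^sup>2 / 4"
      using e by (intro order_tendstoD) auto
    then obtain N where N: "\<And>n. n \<ge> N \<Longrightarrow> (norm (x - Y n))\<^sup>2 - d\<^sup>2 < e\<^sup>2 / 4"
      by (auto simp: eventually_sequentially)
    have "dist (Y m) (Y n) < e" if "m \<ge> N" "n \<ge> N" for m n
    proof -
      have "(norm (Y m - Y n))\<^sup>2 < 2 * (e\<^sup>2 / 4) + 2 * (e\<^sup>2 / 4)"
        using N that
        by (intro le_less_trans[OF near[OF Y(1) Y(1)]] add_strict_mono mult_strict_left_mono) auto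
      then have "(norm (Y m - Y n))\<^sup>2 < e\<^sup>2"
        by simp
      then show ?thesis
        using e by (simp add: dist_norm power2_less_imp_less)
    qed
    then show "\<exists>M. \<forall>m\<ge>M. \<forall>n\<ge>M. dist (Y m) (Y n) < e"
      by blast
  qed
  then obtain u where u: "Y \<longlonglongrightarrow> u"
    using Cauchy_convergent convergent_def by blast
  have "u \<in> S"
    using assms(2) Y(1) u closed_sequentially by blast
  moreover have "norm (x - u) = d"
    by (rule LIMSEQ_unique[OF _ norm_lim]) (intro tendsto_intros u)
  ultimately show thesis
    using that d_le by metis
qed

text \<open>The difference \<open>x - u\<close> to a nearest point \<open>u\<close> is orthogonal to \<open>S\<close>: otherwise moving \<open>u\<close>
  within \<open>S\<close> along a non-orthogonal direction would bring it closer to \<open>x\<close>.\<close>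

lemma orthogonal_decomposition:
  fixes S :: "'a::chilbert_space set"
  assumes "complex_vector.subspace S" and "closed S"
  obtains u v where "x = u + v" and "u \<in> S" and "v \<in> orthocomplement S"
proof -
  obtain u where u: "u \<in> S" and min: "\<And>y. y \<in> S \<Longrightarrow> norm (x - u) \<le> norm (x - y)"
    using nearest_point_exists[OF assms] by metis
  define v where "v = x - u"
  have "cinner v y = 0" if "y \<in> S" for y
  proof (cases "y = 0")
    case True
    then show ?thesis
      using cinner_diff_right[of v y y] by simp
  next
    case False
    define p where "p = cinner v y"
    \<comment> \<open>With this coefficient \<open>c *\<^sub>C y\<close> is the projection of \<open>v\<close> onto the line spanned by \<open>y\<close>,
      so subtracting it shortens \<open>v\<close> as much as possible.\<close>
    define c where "c = p / complex_of_real ((norm y)\<^sup>2)"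
    have "u + c *\<^sub>C y \<in> S"
      using assms(1) u that
      by (simp add: complex_vector.subspace_add complex_vector.subspace_scale)
    from min[OF this] have "norm v \<le> norm (v - c *\<^sub>C y)"
      by (simp add: v_def diff_diff_eq)
    then have le: "(norm v)\<^sup>2 \<le> (norm (v - c *\<^sub>C y))\<^sup>2"
      by (simp add: power_mono)
    have "cinner (v - c *\<^sub>C y) y = 0"
      using False by (simp add: cinner_diff_left cinner_scaleC_left cinner_self c_def p_def)
    then have "cinner (v - c *\<^sub>C y) (c *\<^sub>C y) = 0"
      by (simp add: cinner_scaleC_right)
    from pythagoras[OF this]
    have "(norm v)\<^sup>2 = (norm (v - c *\<^sub>C y))\<^sup>2 + (norm (c *\<^sub>C y))\<^sup>2"
      by simp
    with le have "norm (c *\<^sub>C y) = 0"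
      by simp
    then show ?thesis
      using False by (simp add: norm_scaleC c_def p_def)
  qed
  then show thesis
    using that[of u v] u by (simp add: orthocomplement_def v_def)
qed

section \<open>Krylov subspaces\<close>

lemma orthocomplement_antimono: "S \<subseteq> T \<Longrightarrow> orthocomplement T \<subseteq> orthocomplement S"
  by (auto simp: orthocomplement_def)

lemma subspace_krylov: "complex_vector.subspace (krylov A g)"
  unfolding krylov_def by (rule complex_vector.subspace_span)

lemma self_in_krylov: "g \<in> krylov A g"
proof -
  have "g \<in> {(A ^^ k) g |k. k \<in> (UNIV :: nat set)}"
    by (auto intro: exI[of _ 0])
  then show ?thesis
    unfolding krylov_def by (rule complex_vector.span_base)
qed

lemma krylov_invariant:
  assumes "Vector_Spaces.linear scaleC scaleC A"
  shows "A ` krylov A g \<subseteq> krylov A g"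
proof -
  interpret A: Vector_Spaces.linear scaleC scaleC A
    by (fact assms)
  let ?B = "{(A ^^ k) g |k. k \<in> (UNIV :: nat set)}"
  have "A ` ?B \<subseteq> ?B"
    by (auto intro: exI[of _ "Suc _"])
  then have "cspan (A ` ?B) \<subseteq> cspan ?B"
    by (rule complex_vector.span_mono)
  moreover have "A ` cspan ?B = cspan (A ` ?B)"
    unfolding cspan_def by (rule A.span_image[symmetric])
  ultimately show ?thesis
    unfolding krylov_def by simp
qed

lemma selfadjoint_imp_krylov_reduced:
  assumes "bounded_clinear A" and "selfadjoint A"
  shows "krylov_reduced A g"
proof -
  let ?K = "krylov A g"
  have inv: "A ` ?K \<subseteq> ?K"
    using assms(1) by (intro krylov_invariant) (simp add: bounded_clinear_def)
  have "A ` closure ?K \<subseteq> closure ?K"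
    using inv closure_subset
    by (intro image_closure_subset continuous_on_bounded_clinear assms(1)) auto
  moreover have "A ` orthocomplement ?K \<subseteq> orthocomplement ?K"
    using inv assms(2) by (auto simp: orthocomplement_def selfadjoint_def is_cadjoint_def)
  ultimately show ?thesis
    by (simp add: krylov_reduced_def)
qed

lemma krylov_reduced_imp_solution_in_closure:
  fixes A :: "'a::chilbert_space \<Rightarrow> 'a"
  assumes "Vector_Spaces.linear scaleC scaleC A" and "inj A" and "krylov_reduced A (A f)"
  shows "f \<in> closure (krylov A (A f))"
proof -
  interpret A: Vector_Spaces.linear scaleC scaleC A
    by (fact assms)
  let ?K = "krylov A (A f)"
  have sub: "complex_vector.subspace (closure ?K)"
    by (intro subspace_closure subspace_krylov)
  obtain u v where f: "f = u + v" and u: "u \<in> closure ?K"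
    and v: "v \<in> orthocomplement (closure ?K)"
    using orthogonal_decomposition[OF sub closed_closure] by blast
  have "v \<in> orthocomplement ?K"
    using v orthocomplement_antimono[OF closure_subset] by blast
  then have "A v \<in> orthocomplement ?K"
    using assms(3) by (auto simp: krylov_reduced_def)
  moreover have "A v \<in> closure ?K"
  proof -
    have "A u \<in> closure ?K"
      using assms(3) u by (auto simp: krylov_reduced_def)
    moreover have "A f \<in> closure ?K"
      using self_in_krylov closure_subset by blast
    moreover have "A v = A f - A u"
      unfolding f by (simp add: A.add)
    ultimately show ?thesis
      using sub complex_vector.subspace_diff by metis
  qed
  ultimately have "A v = A 0"
    using closure_orthocomplement_zero A.zero by metis
  then have "v = 0"
    using assms(2) injD by metis
  then show ?thesis
    using f u by simp
qed

theorem proposition3p3: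
  fixes A :: "'a::chilbert_space \<Rightarrow> 'a" and f g :: 'a
  assumes "separable_space (euclidean :: 'a topology)"
    and "bounded_clinear A" and "inj A"
    and "g \<in> range A" and "A f = g"
  shows "(krylov_reduced A g \<longrightarrow> f \<in> closure (krylov A g)) \<and>
         (selfadjoint A \<longrightarrow> f \<in> closure (krylov A g))"
proof -
  have "Vector_Spaces.linear scaleC scaleC A"
    using assms(2) by (simp add: bounded_clinear_def)
  then have "f \<in> closure (krylov A g)" if "krylov_reduced A g"
    using krylov_reduced_imp_solution_in_closure that assms(3,5) by blast
  then show ?thesis
    using selfadjoint_imp_krylov_reduced assms(2) by blast
qed

end
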